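(* Let $d$ be a positive integer. If $P$ and $Q$ are disjoint rational polytopes contained in $\mathbb{R}^d$, then $$d(P,Q)\geq\frac{8}{2^{4\nu(P,Q)(2d)^4}}$$ and $$d(P,Q)\geq\frac{8}{2^{4\varphi(P,Q)(2d)^6}},$$ where $\nu(P,Q)=\max\{\nu(P),\nu(Q)\}$ is the maximum of the vertex complexities of $P$ and $Q$ and $\varphi(P,Q)=\max\{\varphi(P),\varphi(Q)\}$ is the maximum of their facet complexities.
   Context: A polytope is the convex hull of a non-empty finite set of points of $\mathbb{R}^d$; it is rational when its vertices have rational coordinates. $d(P,Q)$ denotes the minimal Euclidean distance between a point of $P$ and a point of $Q$ (the letter $d$ alone denotes the dimension of the ambient space). If $\alpha$ and $\beta$ are relatively prime integers with $\beta>0$, the size of the rational number $\alpha/\beta$ is $$\mathrm{size}\Bigl(\frac{\alpha}{\beta}\Bigr)=1+\bigl\lceil\log_2(|\alpha|+1)\bigr\rceil+\bigl\lceil\log_2(\beta+1)\bigr\rceil.$$ The size of a vector $a\in\mathbb{Q}^d$ is $\mathrm{size}(a)=d+\sum_{i=1}^d\mathrm{size}(a_i)$. The vertex complexity of a rational polytope $P\subset\mathbb{R}^d$ is the smallest number $\nu(P)$ such that $\nu(P)\geq d$ and the size of every vertex of $P$ is at most $\nu(P)$. The facet complexity of a rational polytope $P\subset\mathbb{R}^d$ is the smallest number $\varphi(P)$ such that $\varphi(P)\geq d$ and there exist vectors $a^1,\ldots,a^n\in\mathbb{Q}^d$ and rational numbers $b_1,\ldots,b_n$ (for some $n$) with $$P=\bigl\{x\in\mathbb{R}^d:\forall\,i\in\{1,\ldots,n\},\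 a^i\cdot x\leq b_i\bigr\}$$ and $\mathrm{size}(a^i)+\mathrm{size}(b_i)\leq\varphi(P)$ for all $i\in\{1,\ldots,n\}$. *)

theory Defs
  imports "HOL-Analysis.Analysis"
begin

text \<open>\<open>\<real>\<^sup>d\<close> is rendered as \<^typ>\<open>real ^ 'd\<close>, so that \<open>d = CARD('d)\<close>.\<close>

text \<open>\<^const>\<open>quotient_of\<close> returns the coprime pair with positive denominator. Both logarithms
  are nonnegative, so \<^const>\<open>nat\<close> does not truncate.\<close>

definition rat_size :: "rat \<Rightarrow> nat" where
  "rat_size q = (case quotient_of q of (\<alpha>, \<beta>) \<Rightarrow>
     1 + nat \<lceil>log 2 (real_of_int (\<bar>\<alpha>\<bar> + 1))\<rceil> + nat \<lceil>log 2 (real_of_int (\<beta> + 1))\<rceil>)"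

definition rat_vec_size :: "rat ^ 'd \<Rightarrow> nat" where
  "rat_vec_size a = CARD('d) + (\<Sum>i\<in>UNIV. rat_size (a $ i))"

definition real_vec_of_rat :: "rat ^ 'd \<Rightarrow> real ^ 'd" where
  "real_vec_of_rat a = (\<chi> i. real_of_rat (a $ i))"

text \<open>The library's \<^const>\<open>polytope\<close> admits the empty set. Vertices are extreme points.\<close>

definition rational_polytope :: "(real ^ 'd) set \<Rightarrow> bool" where
  "rational_polytope P \<longleftrightarrow>
     polytope P \<and> P \<noteq> {} \<and> (\<forall>v. v extreme_point_of P \<longrightarrow> (\<forall>i. v $ i \<in> \<rat>))"

text \<open>The two complexities are meaningful only for rational polytopes; for other sets the
  \<open>LEAST\<close> may range over an empty set of candidates.\<close>

definition vertex_complexity :: "(real ^ 'd) set \<Rightarrow> nat" where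
  "vertex_complexity P = (LEAST \<nu>. CARD('d) \<le> \<nu> \<and>
     (\<forall>v. v extreme_point_of P \<longrightarrow>
        (\<exists>a :: rat ^ 'd. v = real_vec_of_rat a \<and> rat_vec_size a \<le> \<nu>)))"

definition facet_complexity :: "(real ^ 'd) set \<Rightarrow> nat" where
  "facet_complexity P = (LEAST \<phi>. CARD('d) \<le> \<phi> \<and>
     (\<exists>(n :: nat) (a :: nat \<Rightarrow> rat ^ 'd) (b :: nat \<Rightarrow> rat).
        P = {x. \<forall>i\<in>{1..n}. real_vec_of_rat (a i) \<bullet> x \<le> real_of_rat (b i)} \<and>
        (\<forall>i\<in>{1..n}. rat_vec_size (a i) + rat_size (b i) \<le> \<phi>)))"

end

theory Submission
  imports Defs
begin

text \<open>Let \<open>p \<in> P\<close> and \<open>q \<in> Q\<close> realize the distance, and let \<open>F\<close> and \<open>G\<close> be the faces of \<open>P\<close> and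
  \<open>Q\<close> cut out by the hyperplanes through \<open>p\<close> and \<open>q\<close> orthogonal to \<open>x = p - q\<close>. The linear system
  \<open>y \<bullet> (v - w) = 1\<close>, with \<open>v\<close> and \<open>w\<close> running through the vertices of \<open>F\<close> and \<open>G\<close>, is solved by
  \<open>x / (x \<bullet> x)\<close>, hence by Cramer's rule also by some \<open>y\<close> of small size. Then \<open>y \<bullet> x = 1\<close>, and so
  \<open>norm x \<ge> 1 / norm y\<close>. For the facet complexity, a vertex is the unique solution of its active
  constraints, so Cramer's rule bounds the vertices as well. Fourier--Motzkin elimination
  provides the rational inequalities without which the \<open>LEAST\<close> in the facet complexity would
  be taken over an empty set.\<close>

section \<open>Rationals with numerator and denominator bounded by a power of two\<close>

text \<open>The fraction need not be in lowest terms, so sums, quotients and determinants can be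
  bounded without any cancellation. Being a predicate on reals, it applies directly to the
  coordinates of vertices and of solutions of linear systems.\<close>

definition frac_bounded :: "nat \<Rightarrow> real \<Rightarrow> bool" where
  "frac_bounded k x \<longleftrightarrow>
     (\<exists>p q :: int. 0 < q \<and> q \<le> 2 ^ k \<and> \<bar>p\<bar> \<le> 2 ^ k \<and> x = real_of_int p / real_of_int q)"

lemma frac_boundedI:
  assumes "0 < q" "q \<le> 2 ^ k" "\<bar>p\<bar> \<le> 2 ^ k" "x = real_of_int p / real_of_int q"
  shows "frac_bounded k x"
  using assms unfolding frac_bounded_def by blast

lemma frac_bounded_mono:
  assumes "frac_bounded k x" "k \<le> l"
  shows "frac_bounded l x"
proof -
  have "(2::int) ^ k \<le> 2 ^ l"
    using assms(2) by (simp add: power_increasing)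
  then show ?thesis
    using assms(1) unfolding frac_bounded_def by (blast intro: order_trans)
qed

lemma frac_bounded_0: "frac_bounded k 0"
  by (rule frac_boundedI[of 1 _ 0]) auto

lemma frac_bounded_1: "frac_bounded k 1"
  by (rule frac_boundedI[of 1 _ 1]) auto

lemma frac_bounded_abs_le:
  assumes "frac_bounded k x"
  shows "\<bar>x\<bar> \<le> 2 ^ k"
proof -
  obtain p q :: int where q: "0 < q" "\<bar>p\<bar> \<le> 2 ^ k" "x = real_of_int p / real_of_int q"
    using assms unfolding frac_bounded_def by blast
  have "\<bar>real_of_int p\<bar> \<le> 2 ^ k"
    using q(2) by (metis of_int_abs of_int_le_numeral_power_cancel_iff)
  moreover have "\<bar>x\<bar> \<le> \<bar>real_of_int p\<bar> / 1"
    unfolding q(3) abs_divide using q(1) by (intro divide_left_mono) auto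
  ultimately show ?thesis by simp
qed

text \<open>Over the common denominator \<open>q * s\<close> the numerator is a difference of two
  products, each at most \<open>2 ^ k * 2 ^ k\<close>; the extra bit absorbs their
  combination.\<close>

lemma frac_bounded_diff:
  assumes "frac_bounded k x" "frac_bounded k y"
  shows "frac_bounded (2 * k + 1) (x - y)"
proof -
  obtain p q :: int where pq: "0 < q" "q \<le> 2 ^ k" "\<bar>p\<bar> \<le> 2 ^ k" "x = real_of_int p / real_of_int q"
    using assms(1) unfolding frac_bounded_def by blast
  obtain r s :: int where rs: "0 < s" "s \<le> 2 ^ k" "\<bar>r\<bar> \<le> 2 ^ k" "y = real_of_int r / real_of_int s"
    using assms(2) unfolding frac_bounded_def by blast
  have two: "(2::int) ^ (2 * k + 1) = 2 * (2 ^ k * 2 ^ k)"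
    by (simp add: power_even_eq power2_eq_square)
  have qs: "q * s \<le> 2 ^ k * 2 ^ k"
    using mult_mono[OF pq(2) rs(2)] rs(1) by simp
  have "\<bar>p * s\<bar> \<le> 2 ^ k * 2 ^ k" "\<bar>r * q\<bar> \<le> 2 ^ k * 2 ^ k"
    unfolding abs_mult using pq rs by (auto intro!: mult_mono)
  then have "\<bar>p * s - r * q\<bar> \<le> 2 ^ (2 * k + 1)"
    unfolding two by linarith
  moreover have "q * s \<le> 2 ^ (2 * k + 1)"
  proof -
    have "(0::int) \<le> 2 ^ k * 2 ^ k" by simp
    then show ?thesis unfolding two using qs by linarith
  qed
  ultimately show ?thesis
    using pq(1) rs(1) unfolding pq(4) rs(4)
    by (intro frac_boundedI[of "q * s" _ "p * s - r * q"]) (auto simp: field_simps)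
qed

lemma frac_bounded_divide:
  assumes "frac_bounded k x" "frac_bounded k y" "y \<noteq> 0"
  shows "frac_bounded (2 * k) (x / y)"
proof -
  obtain p q :: int where pq: "0 < q" "q \<le> 2 ^ k" "\<bar>p\<bar> \<le> 2 ^ k" "x = real_of_int p / real_of_int q"
    using assms(1) unfolding frac_bounded_def by blast
  obtain r s :: int where rs: "0 < s" "s \<le> 2 ^ k" "\<bar>r\<bar> \<le> 2 ^ k" "y = real_of_int r / real_of_int s"
    using assms(2) unfolding frac_bounded_def by blast
  have r: "r \<noteq> 0"
    using assms(3) rs(4) by auto
  have two: "(2::int) ^ (2 * k) = 2 ^ k * 2 ^ k"
    by (simp add: power_even_eq power2_eq_square)
  show ?thesis
  \<comment> \<open>The sign of \<open>r\<close> moves to the numerator so that the denominator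
    stays positive.\<close>
  proof (rule frac_boundedI[of "q * \<bar>r\<bar>" _ "p * s * sgn r"])
    show "0 < q * \<bar>r\<bar>"
      using pq r by simp
    show "q * \<bar>r\<bar> \<le> 2 ^ (2 * k)"
      unfolding two using pq rs by (intro mult_mono) auto
    have "\<bar>p * s * sgn r\<bar> = \<bar>p\<bar> * s"
      using r rs(1) by (simp add: abs_mult abs_sgn_eq)
    also have "\<dots> \<le> 2 ^ (2 * k)"
      unfolding two using pq rs by (intro mult_mono) auto
    finally show "\<bar>p * s * sgn r\<bar> \<le> 2 ^ (2 * k)" .
    show "x / y = real_of_int (p * s * sgn r) / real_of_int (q * \<bar>r\<bar>)"
      using pq rs(1) r unfolding pq(4) rs(4) by (cases "r > 0") (auto simp: field_simps)
  qed
qed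

section \<open>Determinants, Cramer's rule and small solutions of linear systems\<close>

lemma det_Ints:
  fixes A :: "real ^ 'n ^ 'n"
  assumes "\<And>i j. A $ i $ j \<in> \<int>"
  shows "det A \<in> \<int>"
  unfolding det_def using assms by (intro Ints_sum Ints_mult Ints_prod) auto

text \<open>The Leibniz expansion has \<open>fact CARD('n)\<close> terms, each a product of
  \<open>CARD('n)\<close> entries up to sign.\<close>

lemma abs_det_le:
  fixes A :: "real ^ 'n ^ 'n"
  assumes "\<And>i j. \<bar>A $ i $ j\<bar> \<le> M"
  shows "\<bar>det A\<bar> \<le> fact CARD('n) * M ^ CARD('n)"
proof -
  let ?U = "UNIV :: 'n set"
  have "\<bar>det A\<bar> \<le> (\<Sum>p\<in>{p. p permutes ?U}. M ^ CARD('n))"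
    unfolding det_def
  proof (rule order_trans[OF sum_abs], rule sum_mono)
    fix p :: "'n \<Rightarrow> 'n"
    have "\<bar>\<Prod>i\<in>?U. A $ i $ p i\<bar> \<le> (\<Prod>i\<in>?U. M)"
      unfolding abs_prod using assms by (intro prod_mono) auto
    then show "\<bar>of_int (sign p) * (\<Prod>i\<in>?U. A $ i $ p i)\<bar> \<le> M ^ CARD('n)"
      by (simp add: abs_mult sign_def)
  qed
  also have "\<dots> = fact CARD('n) * M ^ CARD('n)"
    by (simp add: card_permutations)
  finally show ?thesis .
qed

text \<open>Scaling row \<open>i\<close> by the product \<open>D i\<close> of its denominators makes
  the matrix integral and multiplies the determinant by \<open>E\<close>, so \<open>E\<close> is a
  denominator of \<open>det A\<close>. Clearing row by row keeps \<open>E\<close> below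
  \<open>2 ^ (k * d^2)\<close>, with \<open>d = CARD('n)\<close>; one common denominator for all
  entries would enter to the power \<open>d\<close>. The numerator is \<open>E * det A\<close>, with
  \<open>det A\<close> bounded by the Leibniz expansion. The exponents \<open>k * d^2\<close>,
  \<open>d^2\<close> and \<open>k * d\<close> are each at most \<open>k * d^2\<close>, whence the
  factor 3.\<close>

lemma frac_bounded_det:
  fixes A :: "real ^ 'n ^ 'n"
  assumes "\<And>i j. frac_bounded k (A $ i $ j)" and "1 \<le> k"
  shows "frac_bounded (3 * k * CARD('n)^2) (det A)"
proof -
  let ?d = "CARD('n)"
  have "\<exists>p q :: int. 0 < q \<and> q \<le> 2 ^ k \<and> A $ i $ j = real_of_int p / real_of_int q" for i j
    using assms(1)[of i j] unfolding frac_bounded_def by blast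
  then obtain p q :: "'n \<Rightarrow> 'n \<Rightarrow> int"
    where q0: "\<And>i j. 0 < q i j" and qk: "\<And>i j. q i j \<le> 2 ^ k"
      and pq: "\<And>i j. A $ i $ j = real_of_int (p i j) / real_of_int (q i j)"
    by metis
  define D where "D = (\<lambda>i. \<Prod>j\<in>UNIV. q i j)"
  define E where "E = (\<Prod>i\<in>UNIV. D i)"
  have D0: "0 < D i" for i
    unfolding D_def using q0 by (simp add: prod_pos)
  have E0: "0 < E"
    unfolding E_def using D0 by (simp add: prod_pos)
  have "D i \<le> (\<Prod>j\<in>(UNIV::'n set). 2 ^ k)" for i
    unfolding D_def using q0 qk by (intro prod_mono) (auto simp: less_imp_le)
  then have "E \<le> (\<Prod>i\<in>(UNIV::'n set). \<Prod>j\<in>(UNIV::'n set). 2 ^ k)"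
    unfolding E_def using D0 by (intro prod_mono) (auto simp: less_imp_le)
  then have Ek: "E \<le> 2 ^ (k * ?d^2)"
    by (simp add: power2_eq_square mult.assoc flip: power_mult)
  have "real_of_int (D i) * A $ i $ j \<in> \<int>" for i j
  proof -
    have "D i = q i j * (\<Prod>l\<in>UNIV - {j}. q i l)"
      unfolding D_def by (simp add: prod.remove)
    then have "real_of_int (D i) * A $ i $ j = real_of_int (p i j * (\<Prod>l\<in>UNIV - {j}. q i l))"
      using q0[of i j] unfolding pq by simp
    then show ?thesis by (metis Ints_of_int)
  qed
  then have "det (\<chi> i. real_of_int (D i) *s A $ i) \<in> \<int>"
    by (intro det_Ints) simp
  moreover have "det (\<chi> i. real_of_int (D i) *s A $ i) = real_of_int E * det A"
    by (simp add: det_rows_mul E_def)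
  ultimately obtain N where N: "real_of_int E * det A = real_of_int N"
    by (metis Ints_cases)
  have dd: "(fact ?d :: real) \<le> 2 ^ (?d^2)"
  proof -
    have "(fact ?d :: real) \<le> real (?d ^ ?d)"
      by (rule fact_le_power)
    also have "\<dots> \<le> (2 ^ ?d) ^ ?d"
      unfolding of_nat_power using of_nat_less_two_power[of ?d]
      by (intro power_mono) (auto simp: less_imp_le)
    finally show ?thesis
      by (simp add: power2_eq_square power_mult)
  qed
  have "\<bar>det A\<bar> \<le> fact ?d * (2 ^ k) ^ ?d"
    using frac_bounded_abs_le[OF assms(1)] by (rule abs_det_le)
  also have "\<dots> \<le> 2 ^ (?d^2) * (2 ^ k) ^ ?d"
    using dd by (intro mult_right_mono) auto
  finally have detb: "\<bar>det A\<bar> \<le> 2 ^ (?d^2 + k * ?d)"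
    by (simp add: power_add power_mult)
  have "\<bar>real_of_int N\<bar> = real_of_int E * \<bar>det A\<bar>"
    unfolding N[symmetric] abs_mult using E0 by simp
  also have "\<dots> \<le> 2 ^ (k * ?d^2) * 2 ^ (?d^2 + k * ?d)"
  proof (intro mult_mono detb)
    show "real_of_int E \<le> 2 ^ (k * ?d^2)"
      using Ek by (metis of_int_le_numeral_power_cancel_iff)
  qed auto
  also have "\<dots> = 2 ^ (k * ?d^2 + (?d^2 + k * ?d))"
    by (simp add: power_add)
  also have "\<dots> \<le> 2 ^ (3 * k * ?d^2)"
  proof (rule power_increasing)
    have "?d \<le> ?d^2" by (simp add: power2_eq_square)
    then have "k * ?d \<le> k * ?d^2" by simp
    moreover have "?d^2 \<le> k * ?d^2" using assms(2) by simp
    ultimately show "k * ?d^2 + (?d^2 + k * ?d) \<le> 3 * k * ?d^2" by linarith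
  qed simp
  finally have Nk: "\<bar>N\<bar> \<le> 2 ^ (3 * k * ?d^2)"
    by (metis of_int_abs of_int_le_numeral_power_cancel_iff)
  show ?thesis
  proof (rule frac_boundedI[OF E0 _ Nk])
    have "(2::int) ^ (k * ?d^2) \<le> 2 ^ (3 * k * ?d^2)"
      by (rule power_increasing) auto
    then show "E \<le> 2 ^ (3 * k * ?d^2)"
      using Ek by linarith
    show "det A = real_of_int N / real_of_int E"
      using N E0 by (simp add: field_simps)
  qed
qed

text \<open>A coordinate of the solution is a quotient of two determinants, and division doubles the
  exponent \<open>3 * k * CARD('n)^2\<close>.\<close>

lemma frac_bounded_cramer:
  fixes A :: "real ^ 'n ^ 'n"
  assumes A: "\<And>i j. frac_bounded k (A $ i $ j)" and b: "\<And>i. frac_bounded k (b $ i)"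
    and k: "1 \<le> k" and "det A \<noteq> 0" and "A *v x = b"
  shows "frac_bounded (6 * k * CARD('n)^2) (x $ i)"
proof -
  have "x = (\<chi> l. det (\<chi> i j. if j = l then b $ i else A $ i $ j) / det A)"
    using cramer[OF \<open>det A \<noteq> 0\<close>] \<open>A *v x = b\<close> by blast
  then have "x $ i = det (\<chi> i' j. if j = i then b $ i' else A $ i' $ j) / det A"
    by (simp add: vec_eq_iff)
  moreover have "frac_bounded (3 * k * CARD('n)^2) (det (\<chi> i' j. if j = i then b $ i' else A $ i' $ j))"
    using A b k by (intro frac_bounded_det) auto
  moreover have "frac_bounded (3 * k * CARD('n)^2) (det A)"
    using A k by (rule frac_bounded_det)
  ultimately show ?thesis
    using frac_bounded_divide[of "3 * k * CARD('n)^2"] \<open>det A \<noteq> 0\<close> by (simp add: mult.assoc)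
qed

text \<open>Maximally many independent equations are kept and completed by \<open>y\<^sub>j = 0\<close> for suitable
  coordinates \<open>j\<close>, so that Cramer's rule applies.\<close>

lemma frac_bounded_linear_system:
  fixes S :: "(real ^ 'n) set"
  assumes S: "\<And>z i. z \<in> S \<Longrightarrow> frac_bounded k (z $ i)"
    and y0: "\<And>z. z \<in> S \<Longrightarrow> frac_bounded k (z \<bullet> y0)" and k: "1 \<le> k"
  obtains y where "\<And>i. frac_bounded (6 * k * CARD('n)^2) (y $ i)"
    and "\<And>z. z \<in> S \<Longrightarrow> z \<bullet> y = z \<bullet> y0"
proof -
  obtain B0 where B0: "B0 \<subseteq> S" "independent B0" "S \<subseteq> span B0"
    using maximal_independent_subset[of S] by blast
  \<comment> \<open>\<open>B\<close> completes the independent equations \<open>B0\<close> to a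
    basis of the whole space by standard basis vectors, whose entries 0 and 1 do not spoil the bound
    \<open>k\<close>.\<close>
  obtain B where B: "B0 \<subseteq> B" "B \<subseteq> B0 \<union> Basis" "independent B" "B0 \<union> Basis \<subseteq> span B"
    using maximal_independent_subset_extend[of B0 "B0 \<union> Basis"] B0(2) by blast
  have "span B = UNIV"
    using B(4) span_mono[of Basis "span B"] by (auto simp: span_span)
  then have "card B = CARD('n)"
    using B(3) dim_span[of B] dim_eq_card_independent[of B] by simp
  moreover have "finite B"
    using B(3) by (simp add: independent_imp_finite)
  ultimately obtain f :: "'n \<Rightarrow> real ^ 'n" where f: "bij_betw f UNIV B"
    using finite_same_card_bij[of "UNIV :: 'n set" B] by auto
  define A where "A = (\<chi> i. f i)"
  define b where "b = (\<chi> i. if f i \<in> B0 then f i \<bullet> y0 else 0)"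
  have rows: "rows A = B"
    using f by (auto simp: rows_def row_def A_def bij_betw_def image_def vec_lambda_eta)
  have "det A \<noteq> 0"
  proof -
    have "\<exists>C. C ** A = mat 1"
      by (subst matrix_left_invertible_span_rows) 
        (simp add: rows \<open>span B = UNIV\<close>)
    then show ?thesis
      by (metis invertible_det_nz invertible_left_inverse)
  qed
  then obtain y where y: "A *v y = b"
    using cramer by blast
  have fy: "f i \<bullet> y = b $ i" for i
    using y by (metis A_def matrix_vector_mul_component vec_lambda_beta)
  have fB: "f i \<in> B" for i
    using f by (auto simp: bij_betw_def)
  have Bk: "frac_bounded k (z $ j)" if "z \<in> B" for z j
  proof (cases "z \<in> B0")
    case True
    then show ?thesis using S B0(1) by blast
  next
    case False
    then obtain i where "z = axis i 1"
      using B(2) \<open>z \<in> B\<close> by (auto simp: Basis_vec_def)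
    then show ?thesis
      by (simp add: axis_def frac_bounded_0 frac_bounded_1)
  qed
  show thesis
  proof
    show "frac_bounded (6 * k * CARD('n)^2) (y $ i)" for i
    proof (rule frac_bounded_cramer[OF _ _ k \<open>det A \<noteq> 0\<close> y])
      show "frac_bounded k (A $ i $ j)" for i j
        using Bk[OF fB] by (simp add: A_def)
      show "frac_bounded k (b $ i)" for i
        using y0 B0(1) by (auto simp: b_def frac_bounded_0)
    qed
    have "z \<bullet> (y - y0) = 0" if "z \<in> B0" for z
    proof -
      have "z \<in> range f"
        using f B(1) that by (auto simp: bij_betw_def)
      then obtain i where "z = f i"
        by blast
      then show ?thesis
        using fy[of i] that by (simp add: b_def inner_diff_right)
    qed
    \<comment> \<open>The dropped equations follow: \<open>y - y0\<close> is orthogonal to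
      \<open>B0\<close>, hence to \<open>span B0\<close>, which contains \<open>S\<close>.\<close>
    then have "z \<bullet> (y - y0) = 0" if "z \<in> S" for z
      using B0(3) that orthogonal_to_span[of z B0 "y - y0"]
      by (auto simp: orthogonal_def inner_commute)
    then show "z \<bullet> y = z \<bullet> y0" if "z \<in> S" for z
      using that by (simp add: inner_diff_right)
  qed
qed

section \<open>Size of the vertices of a polyhedron given by inequalities\<close>

text \<open>The constraints active at \<open>v\<close> have a solution \<open>y\<close> of small
  size. If \<open>y\<close> differed from \<open>v\<close>, a short move from \<open>v\<close> along
  \<open>y - v\<close> in either direction would keep the active constraints tight and the inactive
  ones satisfied, making \<open>v\<close> the midpoint of a segment inside the polyhedron.\<close>

lemma extreme_point_frac_bounded:
  fixes a :: "'i \<Rightarrow> real ^ 'n"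
  assumes "finite I" and a: "\<And>i j. i \<in> I \<Longrightarrow> frac_bounded k (a i $ j)"
    and b: "\<And>i. i \<in> I \<Longrightarrow> frac_bounded k (b i)" and k: "1 \<le> k"
    and v: "v extreme_point_of {x. \<forall>i\<in>I. a i \<bullet> x \<le> b i}"
  shows "frac_bounded (6 * k * CARD('n)^2) (v $ j)"
proof -
  let ?P = "{x. \<forall>i\<in>I. a i \<bullet> x \<le> b i}"
  define S where "S = {a i | i. i \<in> I \<and> a i \<bullet> v = b i}"
  obtain y where y: "\<And>i. frac_bounded (6 * k * CARD('n)^2) (y $ i)"
      and yS: "\<And>z. z \<in> S \<Longrightarrow> z \<bullet> y = z \<bullet> v"
  proof (rule frac_bounded_linear_system[of S k v])
    show "frac_bounded k (z $ i)" if "z \<in> S" for z i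
      using that a by (auto simp: S_def)
    show "frac_bounded k (z \<bullet> v)" if "z \<in> S" for z
      using that b by (auto simp: S_def)
  qed (use k in auto)
  have vP: "v \<in> ?P"
    using v by (simp add: extreme_point_of_def)
  have "y = v"
  proof (rule ccontr)
    assume "y \<noteq> v"
    define u where "u = y - v"
    have "u \<noteq> 0" using \<open>y \<noteq> v\<close> by (simp add: u_def)
    have "\<exists>e>0. \<forall>t. \<bar>t\<bar> \<le> e \<longrightarrow> a i \<bullet> (v + t *\<^sub>R u) \<le> b i" if "i \<in> I" for i
    proof (cases "a i \<bullet> v = b i")
      case True
      then have "a i \<bullet> u = 0"
        using yS[of "a i"] that by (auto simp: S_def u_def inner_diff_right)
      then show ?thesis
        using True by (intro exI[of _ 1]) (simp add: inner_add_right)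
    next
      case False
      then have pos: "0 < b i - a i \<bullet> v"
        using vP that by force
      \<comment> \<open>The summand 1 keeps the denominator positive even when \<open>a i\<close> is
        orthogonal to \<open>u\<close>.\<close>
      define e where "e = (b i - a i \<bullet> v) / (1 + \<bar>a i \<bullet> u\<bar>)"
      have "t * (a i \<bullet> u) \<le> b i - a i \<bullet> v" if "\<bar>t\<bar> \<le> e" for t
      proof -
        have "t * (a i \<bullet> u) \<le> \<bar>t\<bar> * \<bar>a i \<bullet> u\<bar>"
          by (metis abs_ge_self abs_mult)
        also have "\<dots> \<le> e * (1 + \<bar>a i \<bullet> u\<bar>)"
          using that by (intro mult_mono) auto
        also have "\<dots> = b i - a i \<bullet> v"
          by (simp add: e_def)
        finally show ?thesis .
      qed
      moreover have "0 < e"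
        using pos by (simp add: e_def)
      ultimately show ?thesis
        by (intro exI[of _ e]) (auto simp: inner_add_right algebra_simps)
    qed
    then obtain e where e0: "\<And>i. i \<in> I \<Longrightarrow> 0 < e i"
      and e: "\<And>i t. i \<in> I \<Longrightarrow> \<bar>t\<bar> \<le> e i \<Longrightarrow> a i \<bullet> (v + t *\<^sub>R u) \<le> b i"
      by metis
    \<comment> \<open>Inserting 1 makes the minimum well defined and positive also for empty
      \<open>I\<close>.\<close>
    define m where "m = Min (insert 1 (e ` I))"
    have m0: "0 < m"
      unfolding m_def using \<open>finite I\<close> e0 by (subst Min_gr_iff) auto
    have me: "m \<le> e i" if "i \<in> I" for i
      unfolding m_def using \<open>finite I\<close> that by (intro Min_le) auto
    have "v + m *\<^sub>R u \<in> ?P" "v + (- m) *\<^sub>R u \<in> ?P"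
      using e me m0 by (auto simp del: scaleR_minus_left)
    moreover have "v \<in> open_segment (v + (- m) *\<^sub>R u) (v + m *\<^sub>R u)"
      unfolding in_segment using m0 \<open>u \<noteq> 0\<close>
      by (auto intro!: exI[of _ "1/2"] simp: algebra_simps simp flip: scaleR_add_left)
    ultimately show False
      using v unfolding extreme_point_of_def by blast
  qed
  then show ?thesis using y by blast
qed

section \<open>Distance of two polytopes with small vertices\<close>

text \<open>On the exponent: differences of vertices are bounded with
  \<open>2 * k + 1 \<le> 3 * k\<close>, so Cramer's rule bounds the entries of \<open>y\<close> by
  \<open>2 ^ (18 * k * d^2)\<close> with \<open>d = CARD('n)\<close>. Passing to the norm costs a
  factor \<open>d \<le> 2 ^ d\<close>, which turns 18 into 19.\<close>

lemma setdist_ge_frac_bounded: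
  fixes P Q :: "(real ^ 'n) set"
  assumes P: "compact P" "convex P" "P \<noteq> {}" and Q: "compact Q" "convex Q" "Q \<noteq> {}"
    and disj: "P \<inter> Q = {}" and k: "1 \<le> k"
    and vP: "\<And>v i. v extreme_point_of P \<Longrightarrow> frac_bounded k (v $ i)"
    and vQ: "\<And>v i. v extreme_point_of Q \<Longrightarrow> frac_bounded k (v $ i)"
  shows "1 / 2 ^ (19 * k * CARD('n)^2) \<le> setdist P Q"
proof -
  let ?d = "CARD('n)"
  obtain p q where pq: "p \<in> P" "q \<in> Q" "dist p q = setdist P Q"
    using setdist_compact_closed[OF P(1) compact_imp_closed[OF Q(1)] P(3) Q(3)] by metis
  define x where "x = p - q"
  have x0: "x \<noteq> 0"
    using pq disj by (auto simp: x_def)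
  \<comment> \<open>Since \<open>p\<close> is a point of \<open>P\<close> closest to
    \<open>q\<close>, the hyperplane through \<open>p\<close> orthogonal to \<open>x\<close>
    supports \<open>P\<close>; \<open>sQ\<close> is the same with the roles exchanged.\<close>
  have sP: "x \<bullet> z \<ge> x \<bullet> p" if "z \<in> P" for z
  proof -
    have "\<forall>z\<in>P. dist q p \<le> dist q z"
      using pq setdist_le_dist[of _ P q Q] by (metis dist_commute)
    then have "(q - p) \<bullet> (z - p) \<le> 0"
      using any_closest_point_dot[OF P(2) compact_imp_closed[OF P(1)] pq(1) that] by blast
    then show ?thesis
      by (simp add: x_def algebra_simps)
  qed
  have sQ: "x \<bullet> z \<le> x \<bullet> q" if "z \<in> Q" for z
  proof -
    have "\<forall>z\<in>Q. dist p q \<le> dist p z"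
      using pq setdist_le_dist[of p P _ Q] by simp
    then have "(p - q) \<bullet> (z - q) \<le> 0"
      using any_closest_point_dot[OF Q(2) compact_imp_closed[OF Q(1)] pq(2) that] by blast
    then show ?thesis
      by (simp add: x_def algebra_simps)
  qed
  define F where "F = P \<inter> {z. x \<bullet> z = x \<bullet> p}"
  define G where "G = Q \<inter> {z. x \<bullet> z = x \<bullet> q}"
  have F: "F face_of P"
    unfolding F_def by (rule face_of_Int_supporting_hyperplane_ge[OF P(2)]) (rule sP)
  have G: "G face_of Q"
    unfolding G_def by (rule face_of_Int_supporting_hyperplane_le[OF Q(2)]) (rule sQ)
  \<comment> \<open>The points \<open>p\<close> and \<open>q\<close> need not be vertices. Writing
    the faces as hulls of their vertices lets a linear equation pass from those vertices to
    \<open>p\<close> and \<open>q\<close>.\<close>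
  have hF: "F = convex hull {v. v extreme_point_of F}"
    by (rule Krein_Milman_Minkowski[OF face_of_imp_compact[OF P(2,1) F] face_of_imp_convex[OF F]])
  have hG: "G = convex hull {v. v extreme_point_of G}"
    by (rule Krein_Milman_Minkowski[OF face_of_imp_compact[OF Q(2,1) G] face_of_imp_convex[OF G]])
  define S where "S = {v - w | v w. v extreme_point_of F \<and> w extreme_point_of G}"
  define y0 where "y0 = (1 / (x \<bullet> x)) *\<^sub>R x"
  have y0: "z \<bullet> y0 = 1" if "z \<in> S" for z
  proof -
    from that obtain v w where z: "z = v - w" "v extreme_point_of F" "w extreme_point_of G"
      by (auto simp: S_def)
    then have "x \<bullet> v = x \<bullet> p" "x \<bullet> w = x \<bullet> q"
      by (auto simp: extreme_point_of_def F_def G_def)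
    then have "z \<bullet> x = x \<bullet> x"
      by (simp add: z(1) x_def inner_diff_left inner_diff_right inner_commute)
    then show ?thesis
      using x0 by (simp add: y0_def)
  qed
  obtain y where yk: "\<And>i. frac_bounded (6 * (3 * k) * ?d^2) (y $ i)"
      and yS: "\<And>z. z \<in> S \<Longrightarrow> z \<bullet> y = z \<bullet> y0"
  proof (rule frac_bounded_linear_system[of S "3 * k" y0])
    show "frac_bounded (3 * k) (z $ i)" if "z \<in> S" for z i
    proof -
      from that obtain v w where z: "z = v - w" "v extreme_point_of F" "w extreme_point_of G"
        by (auto simp: S_def)
      then have "v extreme_point_of P" "w extreme_point_of Q"
        using F G by (auto simp: extreme_point_of_face)
      then have "frac_bounded (2 * k + 1) (z $ i)"
        using frac_bounded_diff vP vQ by (simp add: z(1))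
      then show ?thesis
        by (rule frac_bounded_mono) (use k in simp)
    qed
    show "frac_bounded (3 * k) (z \<bullet> y0)" if "z \<in> S" for z
      using y0[OF that] by (simp add: frac_bounded_1)
  qed (use k in auto)
  \<comment> \<open>The equations spread in two rounds: for a fixed vertex \<open>w\<close> of
    \<open>G\<close>, from the vertices of \<open>F\<close> to all of \<open>F\<close> and so to
    \<open>p\<close>; then, with \<open>p\<close> in place of \<open>v\<close>, from the vertices of
    \<open>G\<close> to all of \<open>G\<close> and so to \<open>q\<close>.\<close>
  have "v \<bullet> y - w \<bullet> y = 1" if "v extreme_point_of F" "w extreme_point_of G" for v w
    using yS[of "v - w"] y0[of "v - w"] that by (auto simp: S_def inner_diff_left)
  then have "{v. v extreme_point_of F} \<subseteq> {v. y \<bullet> v = 1 + y \<bullet> w}" if "w extreme_point_of G" for w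
    using that by (force simp: inner_commute)
  then have "F \<subseteq> {v. y \<bullet> v = 1 + y \<bullet> w}" if "w extreme_point_of G" for w
    using that by (subst hF, intro hull_minimal convex_hyperplane)
  then have "{w. w extreme_point_of G} \<subseteq> {w. y \<bullet> w = y \<bullet> p - 1}"
    using pq(1) by (force simp: F_def)
  then have "G \<subseteq> {w. y \<bullet> w = y \<bullet> p - 1}"
    by (subst hG, intro hull_minimal convex_hyperplane)
  then have "y \<bullet> x = 1"
    using pq(2) by (auto simp: G_def x_def inner_diff_right)
  then have one: "1 \<le> norm y * norm x"
    using norm_cauchy_schwarz[of y x] by simp
  have "norm y \<le> (\<Sum>i\<in>UNIV. \<bar>y $ i\<bar>)"
    by (rule norm_le_l1_cart)
  also have "\<dots> \<le> (\<Sum>i\<in>(UNIV::'n set). 2 ^ (6 * (3 * k) * ?d^2))"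
    by (intro sum_mono frac_bounded_abs_le yk)
  also have "\<dots> \<le> 2 ^ ?d * 2 ^ (18 * k * ?d^2)"
    using of_nat_less_two_power[of ?d, where ?'a = real] by simp
  also have "\<dots> = 2 ^ (?d + 18 * k * ?d^2)"
    by (simp add: power_add)
  also have "\<dots> \<le> 2 ^ (19 * k * ?d^2)"
  proof (rule power_increasing)
    have "?d * 1 \<le> ?d * (k * ?d)"
      using k by (intro mult_le_mono2) simp
    then show "?d + 18 * k * ?d^2 \<le> 19 * k * ?d^2"
      by (simp add: power2_eq_square algebra_simps)
  qed simp
  finally have "norm y * norm x \<le> 2 ^ (19 * k * ?d^2) * norm x"
    by (rule mult_right_mono) simp
  then have "1 / 2 ^ (19 * k * ?d^2) \<le> norm x"
    using one by (simp add: field_simps)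
  then show ?thesis
    using pq(3) by (simp add: x_def dist_norm)
qed

section \<open>Rational vectors and the meaning of their size\<close>

lemma real_vec_of_rat_component [simp]: "real_vec_of_rat a $ i = real_of_rat (a $ i)"
  by (simp add: real_vec_of_rat_def)

lemma inj_real_vec_of_rat: "inj real_vec_of_rat"
  by (rule injI) (simp add: vec_eq_iff)

lemma real_vec_of_rat_diff: "real_vec_of_rat (a - b) = real_vec_of_rat a - real_vec_of_rat b"
  by (simp add: vec_eq_iff of_rat_diff)

lemma real_vec_of_rat_scale: "real_vec_of_rat (c *s a) = real_of_rat c *\<^sub>R real_vec_of_rat a"
  by (simp add: vec_eq_iff of_rat_mult)

lemma inner_real_vec_of_rat:
  "real_vec_of_rat a \<bullet> real_vec_of_rat b = real_of_rat (\<Sum>i\<in>UNIV. a $ i * b $ i)"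
  by (simp add: inner_vec_def of_rat_sum of_rat_mult)

text \<open>The reduced fraction is the witness: each of the two rounded logarithms in
  \<open>rat_size r\<close> is at most \<open>k\<close>.\<close>

lemma frac_bounded_rat_size: "rat_size r \<le> k \<Longrightarrow> frac_bounded k (real_of_rat r)"
proof -
  assume k: "rat_size r \<le> k"
  obtain p q where pq: "quotient_of r = (p, q)" by fastforce
  have q0: "0 < q" using quotient_of_denom_pos[OF pq] .
  have le: "m \<le> 2 ^ k" if "0 \<le> m" "nat \<lceil>log 2 (real_of_int (m + 1))\<rceil> \<le> k" for m :: int
  proof -
    have "log 2 (real_of_int (m + 1)) \<le> real k"
      using that(2) by linarith
    then have "real_of_int (m + 1) \<le> 2 powr real k"
      using that(1) by (simp add: log_le_iff)
    then have "real_of_int m \<le> 2 ^ k"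
      unfolding powr_realpow[OF zero_less_numeral] of_int_add of_int_1 by linarith
    then show ?thesis
      by (metis of_int_le_numeral_power_cancel_iff)
  qed
  show ?thesis
  proof (rule frac_boundedI[OF q0])
    show "q \<le> 2 ^ k" "\<bar>p\<bar> \<le> 2 ^ k"
      using k q0 unfolding rat_size_def pq
      by (auto intro!: le simp del: of_int_add of_int_abs nat_ceiling_le_eq)
    show "real_of_rat r = real_of_int p / real_of_int q"
      using quotient_of_div[OF pq] by (simp add: of_rat_divide)
  qed
qed

lemma frac_bounded_rat_vec_size:
  assumes "rat_vec_size a \<le> k"
  shows "frac_bounded k (real_vec_of_rat a $ i)"
proof -
  have "rat_size (a $ i) \<le> (\<Sum>i\<in>UNIV. rat_size (a $ i))"
    by (intro member_le_sum) auto
  then have "rat_size (a $ i) \<le> k"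
    using assms by (simp add: rat_vec_size_def)
  then show ?thesis
    by (simp add: frac_bounded_rat_size)
qed

section \<open>Rational inequalities for the convex hull of rational points\<close>

text \<open>Fourier--Motzkin elimination of \<open>t\<close>.\<close>

lemma ex_nonneg_multiple_bounds_iff:
  fixes f c :: "'r \<Rightarrow> real"
  assumes "finite S"
  shows "(\<exists>t\<ge>0. \<forall>r\<in>S. f r \<le> t * c r) \<longleftrightarrow>
    (\<forall>r\<in>S. c r \<le> 0 \<longrightarrow> f r \<le> 0) \<and>
    (\<forall>p\<in>S. \<forall>q\<in>S. 0 < c p \<longrightarrow> c q < 0 \<longrightarrow> c p * f q \<le> c q * f p)"
    (is "?L \<longleftrightarrow> ?R1 \<and> ?R2")
proof (intro iffI conjI ballI impI; (elim conjE)?)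
  fix r assume ?L "r \<in> S" "c r \<le> 0"
  then show "f r \<le> 0"
    by (metis mult_nonneg_nonpos order_trans)
next
  fix p q assume ?L and pq: "p \<in> S" "q \<in> S" "0 < c p" "c q < 0"
  then obtain t where t: "f p \<le> t * c p" "f q \<le> t * c q" by blast
  have "c p * f q \<le> c p * (t * c q)"
    using t(2) pq(3) by simp
  also have "\<dots> = c q * (t * c p)" by simp
  also have "\<dots> \<le> c q * f p"
    using t(1) pq(4) by (simp add: mult_left_mono_neg)
  finally show "c p * f q \<le> c q * f p" .
next
  assume R1: ?R1 and R2: ?R2
  \<comment> \<open>A row with \<open>0 < c p\<close> bounds \<open>t\<close> below by
    \<open>f p / c p\<close>, and 0 is the remaining lower bound. \<open>Max T\<close> is thus the
    least candidate for \<open>t\<close>; the hypotheses say that it respects the upper bounds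
    \<open>f r / c r\<close> from rows with \<open>c r < 0\<close>.\<close>
  define T where "T = insert 0 ((\<lambda>p. f p / c p) ` {p \<in> S. 0 < c p})"
  have T: "finite T" "T \<noteq> {}"
    using assms by (auto simp: T_def)
  have "f r \<le> Max T * c r" if "r \<in> S" for r
  proof (cases "c r" "0 :: real" rule: linorder_cases)
    case equal
    then show ?thesis using R1 that by auto
  next
    case greater
    then have "f r / c r \<le> Max T"
      using T(1) that by (intro Max_ge) (auto simp: T_def)
    then show ?thesis
      using greater by (simp add: field_simps)
  next
    case less
    have "s \<le> f r / c r" if sT: "s \<in> T" for s
    proof (cases "s = 0")
      case True
      then show ?thesis
        using R1 \<open>r \<in> S\<close> less by (simp add: divide_nonpos_neg)
    next
      case False
      then obtain p where p: "p \<in> S" "0 < c p" "s = f p / c p"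
        using sT by (auto simp: T_def)
      then have "c p * f r \<le> c r * f p"
        using R2 \<open>r \<in> S\<close> less by blast
      also have "\<dots> = c p * (s * c r)"
        using p(2,3) by simp
      finally have "f r \<le> s * c r"
        using p(2) by simp
      then show ?thesis
        using less by (simp add: field_simps)
    qed
    then have "Max T \<le> f r / c r"
      using T by simp
    then show ?thesis
      using less by (simp add: field_simps)
  qed
  moreover have "0 \<le> Max T"
    using T(1) by (intro Max_ge) (auto simp: T_def)
  ultimately show ?L by blast
qed

text \<open>Induction on the generators; adding one amounts to eliminating a single nonnegative
  multiplier. The coordinate \<open>s\<close> homogenizes: \<open>s = 1\<close> gives the convex hull.\<close>

lemma rational_cone_halfspaces:
  fixes V :: "(rat ^ 'n) set"
  assumes "finite V"
  shows "\<exists>S :: ((rat ^ 'n) \<times> rat) set. finite S \<and> (\<forall>x s.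
    (\<exists>u. (\<forall>v\<in>V. 0 \<le> u v) \<and> (\<Sum>v\<in>V. u v *\<^sub>R real_vec_of_rat v) = x \<and> sum u V = s) \<longleftrightarrow>
    (\<forall>(a, b)\<in>S. real_vec_of_rat a \<bullet> x \<le> real_of_rat b * s))"
  using assms
proof (induction V)
  case empty
  \<comment> \<open>The cone without generators is the origin, cut out by
    \<open>x $ i \<le> 0\<close>, \<open>- x $ i \<le> 0\<close>, \<open>0 \<le> s\<close> and
    \<open>0 \<le> - s\<close>.\<close>
  let ?S = "(\<lambda>i. (axis i 1, 0)) ` UNIV \<union> (\<lambda>i. (axis i (- 1), 0)) ` UNIV \<union> {(0, 1), (0, - 1)}
    :: ((rat ^ 'n) \<times> rat) set"
  have ax: "real_vec_of_rat (axis i c) \<bullet> x = real_of_rat c * x $ i" for i c and x :: "real ^ 'n"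
  proof -
    have "real_vec_of_rat (axis i c) = axis i (real_of_rat c)"
      by (simp add: vec_eq_iff axis_def)
    then show ?thesis by (simp add: inner_axis')
  qed
  have z: "real_vec_of_rat (0 :: rat ^ 'n) = 0"
    by (simp add: vec_eq_iff)
  have "(0 = x \<and> 0 = s) \<longleftrightarrow> (\<forall>(a, b)\<in>?S. real_vec_of_rat a \<bullet> x \<le> real_of_rat b * s)"
    for x :: "real ^ 'n" and s :: real
    by (auto simp: ball_Un ax z vec_eq_iff of_rat_minus intro: antisym)
  then show ?case
    by (intro exI[of _ ?S]) simp
next
  case (insert v V)
  let ?rv = "real_vec_of_rat :: rat ^ 'n \<Rightarrow> real ^ 'n"
  define cone where "cone W x s \<longleftrightarrow>
    (\<exists>u. (\<forall>v\<in>W. 0 \<le> u v) \<and> (\<Sum>v\<in>W. u v *\<^sub>R ?rv v) = x \<and> sum u W = s)" for W x s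
  obtain S where S: "finite S"
    and cV: "\<And>x s. cone V x s \<longleftrightarrow> (\<forall>(a, b)\<in>S. ?rv a \<bullet> x \<le> real_of_rat b * s)"
    using insert.IH unfolding cone_def by blast
  \<comment> \<open>\<open>c r\<close> and \<open>f x s r\<close> evaluate the homogeneous form of
    \<open>r\<close> at \<open>(v, 1)\<close> and at \<open>(x, s)\<close>. Removing
    \<open>t\<close> times the new generator turns the constraint into
    \<open>f x s r \<le> t * c r\<close>.\<close>
  define c where "c r = (\<Sum>i\<in>UNIV. fst r $ i * v $ i) - snd r" for r :: "(rat ^ 'n) \<times> rat"
  define f where "f x s r = ?rv (fst r) \<bullet> x - real_of_rat (snd r) * s" for x s r
  have c: "real_of_rat (c r) = ?rv (fst r) \<bullet> ?rv v - real_of_rat (snd r)" for r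
    by (simp add: c_def of_rat_diff inner_real_vec_of_rat)
  \<comment> \<open>For \<open>0 < c p\<close> and \<open>c q < 0\<close> this is the combination of
    \<open>q\<close> and \<open>p\<close> with positive multipliers \<open>c p\<close> and
    \<open>- c q\<close> whose value at \<open>(v, 1)\<close> vanishes, so \<open>t\<close> drops
    out.\<close>
  define comb where "comb p q = (c p *s fst q - c q *s fst p, c p * snd q - c q * snd p)" for p q
  define S' where "S' = {r \<in> S. c r \<le> 0} \<union>
    (\<lambda>(p, q). comb p q) ` ({p \<in> S. 0 < c p} \<times> {q \<in> S. c q < 0})"
  have f_comb: "f x s (comb p q) = real_of_rat (c p) * f x s q - real_of_rat (c q) * f x s p"
    for x s p q
    by (simp add: f_def comb_def real_vec_of_rat_diff real_vec_of_rat_scale of_rat_diff of_rat_mult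
        inner_diff_left algebra_simps)
  have "cone (insert v V) x s \<longleftrightarrow> (\<forall>(a, b)\<in>S'. ?rv a \<bullet> x \<le> real_of_rat b * s)" for x s
  proof -
    have "cone (insert v V) x s \<longleftrightarrow> (\<exists>t\<ge>0. cone V (x - t *\<^sub>R ?rv v) (s - t))"
    proof
      assume "cone (insert v V) x s"
      then obtain u where "\<forall>w\<in>insert v V. 0 \<le> u w"
        "(\<Sum>w\<in>insert v V. u w *\<^sub>R ?rv w) = x" "sum u (insert v V) = s"
        unfolding cone_def by blast
      then show "\<exists>t\<ge>0. cone V (x - t *\<^sub>R ?rv v) (s - t)"
        unfolding cone_def using insert.hyps by (intro exI[of _ "u v"] conjI exI[of _ u]) auto
    next
      assume "\<exists>t\<ge>0. cone V (x - t *\<^sub>R ?rv v) (s - t)"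
      then obtain t u where t: "0 \<le> t" and u: "\<forall>w\<in>V. 0 \<le> u w"
        "(\<Sum>w\<in>V. u w *\<^sub>R ?rv w) = x - t *\<^sub>R ?rv v" "sum u V = s - t"
        unfolding cone_def by blast
      \<comment> \<open>As \<open>v\<close> is not in \<open>V\<close>, its coefficient can be set
        to \<open>t\<close> without affecting the sums over \<open>V\<close>.\<close>
      have "(\<Sum>w\<in>V. (u(v := t)) w *\<^sub>R ?rv w) = (\<Sum>w\<in>V. u w *\<^sub>R ?rv w)" "sum (u(v := t)) V = sum u V"
        using insert.hyps(2) by (auto intro!: sum.cong)
      then show "cone (insert v V) x s"
        unfolding cone_def using insert.hyps t u by (intro exI[of _ "u(v := t)"]) simp
    qed
    also have "\<dots> \<longleftrightarrow> (\<exists>t\<ge>0. \<forall>r\<in>S. f x s r \<le> t * real_of_rat (c r))"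
      unfolding cV c f_def by (simp add: split_beta inner_diff_right algebra_simps)
    also have "\<dots> \<longleftrightarrow> (\<forall>r\<in>S'. f x s r \<le> 0)"
      unfolding ex_nonneg_multiple_bounds_iff[OF S] S'_def
      by (simp add: ball_Un f_comb) (simp add: split_paired_all Ball_def conj_imp_eq_imp_imp; blast)
    also have "\<dots> \<longleftrightarrow> (\<forall>(a, b)\<in>S'. ?rv a \<bullet> x \<le> real_of_rat b * s)"
      by (simp add: f_def split_beta)
    finally show ?thesis .
  qed
  moreover have "finite S'"
    using S by (simp add: S'_def)
  ultimately show ?case
    unfolding cone_def by blast
qed

text \<open>This is the slice \<open>s = 1\<close> of the cone. Weights on rational vectors and
  weights on their real images correspond because \<open>real_vec_of_rat\<close> is
  injective.\<close>

lemma rational_convex_hull_halfspaces: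
  fixes V :: "(rat ^ 'n) set"
  assumes "finite V"
  obtains S :: "((rat ^ 'n) \<times> rat) set" where "finite S"
    and "convex hull (real_vec_of_rat ` V) = {x. \<forall>(a, b)\<in>S. real_vec_of_rat a \<bullet> x \<le> real_of_rat b}"
proof -
  obtain S :: "((rat ^ 'n) \<times> rat) set" where S: "finite S" "\<And>x s.
    (\<exists>u. (\<forall>v\<in>V. 0 \<le> u v) \<and> (\<Sum>v\<in>V. u v *\<^sub>R real_vec_of_rat v) = x \<and> sum u V = s) \<longleftrightarrow>
    (\<forall>(a, b)\<in>S. real_vec_of_rat a \<bullet> x \<le> real_of_rat b * s)"
    using rational_cone_halfspaces[OF assms] by blast
  have inj: "inj_on real_vec_of_rat V"
    using inj_real_vec_of_rat inj_on_subset by blast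
  have "x \<in> convex hull (real_vec_of_rat ` V) \<longleftrightarrow>
    (\<exists>u. (\<forall>v\<in>V. 0 \<le> u v) \<and> (\<Sum>v\<in>V. u v *\<^sub>R real_vec_of_rat v) = x \<and> sum u V = 1)" (is "?L \<longleftrightarrow> ?R")
    for x
  proof
    assume ?L
    then obtain u where "\<forall>y\<in>real_vec_of_rat ` V. 0 \<le> u y" "sum u (real_vec_of_rat ` V) = 1"
      "(\<Sum>y\<in>real_vec_of_rat ` V. u y *\<^sub>R y) = x"
      using assms by (auto simp: convex_hull_finite)
    then show ?R
      using inj by (intro exI[of _ "u \<circ> real_vec_of_rat"]) (simp add: sum.reindex)
  next
    assume ?R
    then obtain u where u: "\<forall>v\<in>V. 0 \<le> u v" "(\<Sum>v\<in>V. u v *\<^sub>R real_vec_of_rat v) = x" "sum u V = 1"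
      by blast
    let ?w = "u \<circ> inv_into UNIV real_vec_of_rat"
    have "\<forall>y\<in>real_vec_of_rat ` V. 0 \<le> ?w y" "sum ?w (real_vec_of_rat ` V) = 1"
      "(\<Sum>y\<in>real_vec_of_rat ` V. ?w y *\<^sub>R y) = x"
      using u inj by (auto simp: sum.reindex inv_f_f[OF inj_real_vec_of_rat])
    then show ?L
      using assms by (auto simp: convex_hull_finite)
  qed
  then have "convex hull (real_vec_of_rat ` V) = {x. \<forall>(a, b)\<in>S. real_vec_of_rat a \<bullet> x \<le> real_of_rat b}"
    using S(2)[where s = 1] by auto
  then show thesis
    using S(1) that by blast
qed

section \<open>Vertex and facet complexity of rational polytopes\<close>

lemma rational_polytope_vertices:
  fixes P :: "(real ^ 'n) set"
  assumes "rational_polytope P"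
  obtains V :: "(rat ^ 'n) set"
  where "finite V" and "{v. v extreme_point_of P} = real_vec_of_rat ` V"
proof -
  let ?E = "{v. v extreme_point_of P}"
  have rat: "\<exists>a. v = real_vec_of_rat a" if "v extreme_point_of P" for v
  proof -
    have "\<forall>i. \<exists>r. v $ i = real_of_rat r"
      using assms that unfolding rational_polytope_def by (metis Rats_cases)
    then obtain r where "\<And>i. v $ i = real_of_rat (r i)" by metis
    then have "v = real_vec_of_rat (\<chi> i. r i)"
      by (simp add: vec_eq_iff)
    then show ?thesis by blast
  qed
  have "finite ?E"
    using assms by (simp add: rational_polytope_def finite_polyhedron_extreme_points
        polytope_imp_polyhedron)
  moreover have "?E \<subseteq> real_vec_of_rat ` UNIV"
    using rat by blast
  ultimately show thesis
    using that finite_subset_image[of ?E real_vec_of_rat UNIV] by metis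
qed

text \<open>The \<open>LEAST\<close> is attained because a candidate exists: the dimension plus the
  sum of the sizes of the finitely many vertices.\<close>

lemma vertex_complexity_spec:
  fixes P :: "(real ^ 'n) set"
  assumes "rational_polytope P"
  shows "CARD('n) \<le> vertex_complexity P \<and> (\<forall>v. v extreme_point_of P \<longrightarrow>
    (\<exists>a :: rat ^ 'n. v = real_vec_of_rat a \<and> rat_vec_size a \<le> vertex_complexity P))"
proof -
  obtain V :: "(rat ^ 'n) set" where V: "finite V" "{v. v extreme_point_of P} = real_vec_of_rat ` V"
    using rational_polytope_vertices[OF assms] .
  have le: "rat_vec_size a \<le> CARD('n) + sum rat_vec_size V" if "a \<in> V" for a
    using member_le_sum[of a V rat_vec_size] V(1) that by simp
  show ?thesis
    unfolding vertex_complexity_def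
  proof (rule LeastI[of _ "CARD('n) + sum rat_vec_size V"], intro conjI allI impI)
    fix v assume "v extreme_point_of P"
    then show "\<exists>a :: rat ^ 'n. v = real_vec_of_rat a \<and> rat_vec_size a \<le> CARD('n) + sum rat_vec_size V"
      using V(2) le by blast
  qed simp
qed

text \<open>A candidate for the \<open>LEAST\<close> comes from the rational halfspaces describing
  the hull of the vertices: the dimension plus the sum of the sizes of all these
  inequalities.\<close>

lemma facet_complexity_spec:
  fixes P :: "(real ^ 'n) set"
  assumes "rational_polytope P"
  shows "CARD('n) \<le> facet_complexity P \<and>
     (\<exists>(n :: nat) (a :: nat \<Rightarrow> rat ^ 'n) (b :: nat \<Rightarrow> rat).
        P = {x. \<forall>i\<in>{1..n}. real_vec_of_rat (a i) \<bullet> x \<le> real_of_rat (b i)} \<and>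
        (\<forall>i\<in>{1..n}. rat_vec_size (a i) + rat_size (b i) \<le> facet_complexity P))"
proof -
  obtain V :: "(rat ^ 'n) set" where V: "finite V" "{v. v extreme_point_of P} = real_vec_of_rat ` V"
    using rational_polytope_vertices[OF assms] .
  obtain S :: "((rat ^ 'n) \<times> rat) set" where S: "finite S"
    "convex hull (real_vec_of_rat ` V) = {x. \<forall>(a, b)\<in>S. real_vec_of_rat a \<bullet> x \<le> real_of_rat b}"
    using rational_convex_hull_halfspaces[OF V(1)] .
  have "P = convex hull {v. v extreme_point_of P}"
    using assms by (intro Krein_Milman_Minkowski)
      (auto simp: rational_polytope_def polytope_imp_compact polytope_imp_convex)
  then have P: "P = {x. \<forall>(a, b)\<in>S. real_vec_of_rat a \<bullet> x \<le> real_of_rat b}"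
    using V(2) S(2) by simp
  obtain h where h: "bij_betw h {1..card S} S"
    using ex_bij_betw_nat_finite_1[OF S(1)] by blast
  then have hS: "S = h ` {1..card S}"
    by (simp add: bij_betw_def)
  define a where "a = fst \<circ> h"
  define b where "b = snd \<circ> h"
  define m where "m = CARD('n) + (\<Sum>i\<in>{1..card S}. rat_vec_size (a i) + rat_size (b i))"
  have "P = {x. \<forall>i\<in>{1..card S}. real_vec_of_rat (a i) \<bullet> x \<le> real_of_rat (b i)}"
    unfolding P by (subst hS) (simp add: a_def b_def split_beta)
  moreover have "\<forall>i\<in>{1..card S}. rat_vec_size (a i) + rat_size (b i) \<le> m"
    unfolding m_def
    by (intro ballI trans_le_add2 member_le_sum[of _ _ "\<lambda>i. rat_vec_size (a i) + rat_size (b i)"]) auto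
  ultimately have "CARD('n) \<le> m \<and>
     (\<exists>(n :: nat) (a :: nat \<Rightarrow> rat ^ 'n) (b :: nat \<Rightarrow> rat).
        P = {x. \<forall>i\<in>{1..n}. real_vec_of_rat (a i) \<bullet> x \<le> real_of_rat (b i)} \<and>
        (\<forall>i\<in>{1..n}. rat_vec_size (a i) + rat_size (b i) \<le> m))"
    by (intro conjI exI[of _ "card S"] exI[of _ a] exI[of _ b]) (simp_all add: m_def)
  then show ?thesis
    unfolding facet_complexity_def by (rule LeastI)
qed

lemma vertex_frac_bounded_vertex_complexity:
  assumes "rational_polytope P" "vertex_complexity P \<le> k" "v extreme_point_of P"
  shows "frac_bounded k (v $ i)"
proof -
  obtain a where "v = real_vec_of_rat a" "rat_vec_size a \<le> k"
    using vertex_complexity_spec[OF assms(1)] assms(2,3) by (meson order_trans)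
  then show ?thesis
    by (metis frac_bounded_rat_vec_size)
qed

text \<open>In a description attaining the facet complexity all coefficients and right-hand sides
  have size at most \<open>k\<close>, so the bound on vertices of polyhedra applies.\<close>

lemma vertex_frac_bounded_facet_complexity:
  fixes P :: "(real ^ 'n) set"
  assumes "rational_polytope P" "facet_complexity P \<le> k" "v extreme_point_of P"
  shows "frac_bounded (6 * k * CARD('n)^2) (v $ i)"
proof -
  obtain n :: nat and a :: "nat \<Rightarrow> rat ^ 'n" and b :: "nat \<Rightarrow> rat"
    where P: "P = {x. \<forall>i\<in>{1..n}. real_vec_of_rat (a i) \<bullet> x \<le> real_of_rat (b i)}"
      and ab: "\<forall>i\<in>{1..n}. rat_vec_size (a i) + rat_size (b i) \<le> facet_complexity P"
    using facet_complexity_spec[OF assms(1)] by blast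
  have "CARD('n) \<le> k"
    using facet_complexity_spec[OF assms(1)] assms(2) by linarith
  then have k: "1 \<le> k"
    using zero_less_card_finite[where ?'a = 'n] by linarith
  have abk: "rat_vec_size (a i) \<le> k" "rat_size (b i) \<le> k" if "i \<in> {1..n}" for i
    using ab assms(2) that by fastforce+
  show ?thesis
  proof (rule extreme_point_frac_bounded[OF _ _ _ k])
    show "v extreme_point_of {x. \<forall>i\<in>{1..n}. real_vec_of_rat (a i) \<bullet> x \<le> real_of_rat (b i)}"
      using assms(3) P by simp
    show "frac_bounded k (real_vec_of_rat (a i) $ j)" if "i \<in> {1..n}" for i j
      using that abk by (blast intro: frac_bounded_rat_vec_size)
    show "frac_bounded k (real_of_rat (b i))" if "i \<in> {1..n}" for i
      using that abk by (blast intro: frac_bounded_rat_size)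
  qed simp
qed

section \<open>Comparison of the exponents with the stated bounds\<close>

theorem theorem6p5:
  fixes P Q :: "(real ^ 'd) set"
  assumes "rational_polytope P" and "rational_polytope Q"
    and "P \<inter> Q = {}"
  shows "setdist P Q
           \<ge> 8 / 2 ^ (4 * max (vertex_complexity P) (vertex_complexity Q) * (2 * CARD('d)) ^ 4)
       \<and> setdist P Q
           \<ge> 8 / 2 ^ (4 * max (facet_complexity P) (facet_complexity Q) * (2 * CARD('d)) ^ 6)"
proof -
  let ?d = "CARD('d)"
  let ?nu = "max (vertex_complexity P) (vertex_complexity Q)"
  let ?phi = "max (facet_complexity P) (facet_complexity Q)"
  have d: "1 \<le> ?d"
    using zero_less_card_finite[where ?'a = 'd] by linarith
  have nu: "1 \<le> ?nu"
    using vertex_complexity_spec[OF assms(1)] d by linarith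
  have phi: "1 \<le> ?phi"
    using facet_complexity_spec[OF assms(1)] d by linarith
  have dist: "1 / 2 ^ (19 * k * ?d^2) \<le> setdist P Q"
    if "1 \<le> k" "\<And>v i. v extreme_point_of P \<Longrightarrow> frac_bounded k (v $ i)"
      "\<And>v i. v extreme_point_of Q \<Longrightarrow> frac_bounded k (v $ i)" for k
    using assms that by (intro setdist_ge_frac_bounded)
      (auto simp: rational_polytope_def polytope_imp_compact polytope_imp_convex)
  \<comment> \<open>The numerator \<open>8 = 2 ^ 3\<close> costs 3 in the exponent.\<close>
  have weaken: "8 / 2 ^ n \<le> setdist P Q" if "1 / 2 ^ m \<le> setdist P Q" "m + 3 \<le> n" for m n :: nat
  proof -
    have "(2 :: real) ^ (m + 3) \<le> 2 ^ n"
      using that(2) by (intro power_increasing) auto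
    then have "8 / 2 ^ n \<le> (8 :: real) / 2 ^ (m + 3)"
      by (intro divide_left_mono) auto
    also have "\<dots> = 1 / 2 ^ m"
      by (simp add: power_add)
    finally show ?thesis using that(1) by linarith
  qed
  show ?thesis
  proof
    show "8 / 2 ^ (4 * ?nu * (2 * ?d) ^ 4) \<le> setdist P Q"
    proof (rule weaken)
      show "1 / 2 ^ (19 * ?nu * ?d^2) \<le> setdist P Q"
        using assms nu by (intro dist vertex_frac_bounded_vertex_complexity) auto
      \<comment> \<open>Here \<open>4 * (2 * d) ^ 4 = 64 * d ^ 4\<close>, and
        \<open>19 + 3 \<le> 64\<close> once \<open>d^2\<close> is raised to
        \<open>d^4\<close>.\<close>
      have "?nu * ?d^2 \<le> ?nu * ?d^4"
        by (intro mult_le_mono2 power_increasing d) simp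
      moreover have "1 \<le> ?nu * ?d^4"
        using nu d by simp
      ultimately have "19 * (?nu * ?d^2) + 3 \<le> 64 * (?nu * ?d^4)"
        by linarith
      then show "19 * ?nu * ?d^2 + 3 \<le> 4 * ?nu * (2 * ?d) ^ 4"
        by (simp add: power_mult_distrib mult.assoc)
    qed
    show "8 / 2 ^ (4 * ?phi * (2 * ?d) ^ 6) \<le> setdist P Q"
    proof (rule weaken)
      show "1 / 2 ^ (19 * (6 * ?phi * ?d^2) * ?d^2) \<le> setdist P Q"
        using assms phi d by (intro dist vertex_frac_bounded_facet_complexity) auto
      \<comment> \<open>Here \<open>4 * (2 * d) ^ 6 = 256 * d ^ 6\<close>, against
        \<open>19 * 6 + 3 = 117\<close> once \<open>d^4\<close> is raised to
        \<open>d^6\<close>.\<close>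
      have "?phi * ?d^4 \<le> ?phi * ?d^6"
        by (intro mult_le_mono2 power_increasing d) simp
      moreover have "1 \<le> ?phi * ?d^6"
        using phi d by simp
      moreover have "19 * (6 * ?phi * ?d^2) * ?d^2 = 114 * (?phi * ?d^4)"
        by (simp add: power2_eq_square power4_eq_xxxx)
      ultimately have "19 * (6 * ?phi * ?d^2) * ?d^2 + 3 \<le> 256 * (?phi * ?d^6)"
        by linarith
      also have "\<dots> = 4 * ?phi * (2 * ?d) ^ 6"
        by (simp add: power_mult_distrib)
      finally show "19 * (6 * ?phi * ?d^2) * ?d^2 + 3 \<le> 4 * ?phi * (2 * ?d) ^ 6" .
    qed
  qed
qed

end
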